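(* Let $\Gamma$ be a finite simple graph (not necessarily connected) with $n=|V_\Gamma|$ vertices and $m=|E_\Gamma|$ edges, and let $\Delta$ be its graph Laplacian. Then $$\det(\Delta+\lambda I)=\sum_{i=0}^{n}|\mathcal{M}_{m-i}(\Gamma)|\,\lambda^{n-i},$$ where $\mathcal{M}_k(\Gamma)=\emptyset$ for $k<0$.
   Context: The graph Laplacian is $\Delta=\partial_1\partial_1^T=D-A$ ($D$ the diagonal degree matrix, $A$ the adjacency matrix), an $n\times n$ matrix, and $I$ is the $n\times n$ identity. A discrete Morse function on $\Gamma$ (viewed as a $1$-dimensional simplicial complex) is $f:\Gamma\to\mathbb{R}$ such that each vertex $v$ has at most one incident edge $e$ with $f(e)\le f(v)$ and each edge $e$ has at most one endpoint $v$ with $f(v)\ge f(e)$; a cell is critical if no such pairing exists. The gradient is $V_f=\{(v,e): v \text{ an endpoint of } e,\ f(e)\le f(v)\}$. $\mathcal{M}(\Gamma)$ is the set of discrete Morse functions modulo $f\sim g$ iff $V_f=V_g$, and $\mathcal{M}_k(\Gamma)$ is the subset of classes with exactly $k$ critical edges. *)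

theory Defs
  imports "HOL-Library.FuncSet" "Jordan_Normal_Form.Determinant"
begin

locale finite_simple_graph =
  fixes V :: "'a set" and E :: "'a set set"
  assumes finite_vertices: "finite V"
    and edge_subset: "e \<in> E \<Longrightarrow> e \<subseteq> V"
    and edge_card: "e \<in> E \<Longrightarrow> card e = 2"
begin

lemma finite_edges: "finite E"
  by (rule finite_subset[of _ "Pow V"]) (use edge_subset finite_vertices in auto)

end

text \<open>
  The matrices are taken with respect to an enumeration \<open>vs\<close> of the vertices: row and
  column \<open>i\<close> belong to the vertex \<open>vs ! i\<close>.
\<close>

definition degree_matrix :: "'a list \<Rightarrow> 'a set set \<Rightarrow> real mat" where
  "degree_matrix vs E = mat (length vs) (length vs)
     (\<lambda>(i, j). if i = j then real (card {e \<in> E. vs ! i \<in> e}) else 0)"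

definition adjacency_matrix :: "'a list \<Rightarrow> 'a set set \<Rightarrow> real mat" where
  "adjacency_matrix vs E = mat (length vs) (length vs)
     (\<lambda>(i, j). if {vs ! i, vs ! j} \<in> E then 1 else 0)"

definition laplacian :: "'a list \<Rightarrow> 'a set set \<Rightarrow> real mat" where
  "laplacian vs E = degree_matrix vs E - adjacency_matrix vs E"

text \<open>
  The cells of the 1-dimensional simplicial complex; a vertex \<open>v\<close> is the cell \<open>{v}\<close>, so
  the value of a function on a vertex is \<open>f {v}\<close>.
\<close>

definition cells :: "'a set \<Rightarrow> 'a set set \<Rightarrow> 'a set set" where
  "cells V E = (\<lambda>v. {v}) ` V \<union> E"

text \<open>\<open>extensional\<close> makes these functions on the cells, with no further values.\<close>

definition discrete_morse_functions :: "'a set \<Rightarrow> 'a set set \<Rightarrow> ('a set \<Rightarrow> real) set" where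
  "discrete_morse_functions V E = {f \<in> extensional (cells V E).
     (\<forall>v\<in>V. \<exists>\<^sub>\<le>\<^sub>1 e. e \<in> E \<and> v \<in> e \<and> f e \<le> f {v}) \<and>
     (\<forall>e\<in>E. \<exists>\<^sub>\<le>\<^sub>1 v. v \<in> e \<and> f {v} \<ge> f e)}"

definition gradient :: "'a set \<Rightarrow> 'a set set \<Rightarrow> ('a set \<Rightarrow> real) \<Rightarrow> ('a \<times> 'a set) set" where
  "gradient V E f = {(v, e). v \<in> V \<and> e \<in> E \<and> v \<in> e \<and> f e \<le> f {v}}"

definition critical :: "'a set \<Rightarrow> 'a set set \<Rightarrow> ('a set \<Rightarrow> real) \<Rightarrow> 'a set \<Rightarrow> bool" where
  "critical V E f c \<longleftrightarrow> c \<in> cells V E \<and>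
     \<not> (\<exists>v\<in>V. \<exists>e\<in>E. v \<in> e \<and> f e \<le> f {v} \<and> (c = {v} \<or> c = e))"

definition gradient_equiv ::
    "'a set \<Rightarrow> 'a set set \<Rightarrow> (('a set \<Rightarrow> real) \<times> ('a set \<Rightarrow> real)) set" where
  "gradient_equiv V E = {(f, g). f \<in> discrete_morse_functions V E \<and>
     g \<in> discrete_morse_functions V E \<and> gradient V E f = gradient V E g}"

definition morse_classes :: "'a set \<Rightarrow> 'a set set \<Rightarrow> ('a set \<Rightarrow> real) set set" where
  "morse_classes V E = discrete_morse_functions V E // gradient_equiv V E"

text \<open>
  All representatives of a class have the same critical cells (lemma \<open>critical_cong\<close>
  below). The index is an integer, so the set is empty for negative \<open>k\<close>.
\<close>

definition morse_classes_crit :: "'a set \<Rightarrow> 'a set set \<Rightarrow> int \<Rightarrow> ('a set \<Rightarrow> real) set set" where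
  "morse_classes_crit V E k =
     {C \<in> morse_classes V E. \<exists>f\<in>C. int (card {e \<in> E. critical V E f e}) = k}"

lemma critical_cong:
  assumes "gradient V E f = gradient V E g"
  shows "critical V E f c \<longleftrightarrow> critical V E g c"
proof -
  have "critical V E h c \<longleftrightarrow> c \<in> cells V E \<and>
      \<not> (\<exists>(v, e)\<in>gradient V E h. c = {v} \<or> c = e)" for h
    by (auto simp: critical_def gradient_def)
  then show ?thesis using assms by simp
qed

lemma equiv_gradient_equiv:
  "equiv (discrete_morse_functions V E) (gradient_equiv V E)"
  by (rule equivI) (auto simp: gradient_equiv_def refl_on_def sym_def trans_def)

text \<open>Hence \<open>card\<close> of these sets is never the default value for infinite sets.\<close>

lemma (in finite_simple_graph) finite_morse_classes: "finite (morse_classes V E)"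
proof -
  let ?M = "discrete_morse_functions V E" and ?R = "gradient_equiv V E"
  let ?h = "\<lambda>P. {f \<in> ?M. gradient V E f = P}"
  have "morse_classes V E \<subseteq> ?h ` Pow (V \<times> E)"
  proof
    fix C assume "C \<in> morse_classes V E"
    then obtain f where f: "f \<in> ?M" "C = ?R `` {f}"
      unfolding morse_classes_def by (auto elim: quotientE)
    then have "C = ?h (gradient V E f)" by (auto simp: gradient_equiv_def)
    moreover have "gradient V E f \<in> Pow (V \<times> E)" by (auto simp: gradient_def)
    ultimately show "C \<in> ?h ` Pow (V \<times> E)" by blast
  qed
  then show ?thesis
    using finite_vertices finite_edges by (meson finite_SigmaI finite_Pow_iff finite_imageI finite_subset)
qed

lemma (in finite_simple_graph) finite_morse_classes_crit: "finite (morse_classes_crit V E k)"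
  using finite_morse_classes by (simp add: morse_classes_crit_def)

end

theory Submission imports Defs begin

text \<open>
  A gradient on a graph pairs each non-critical vertex with an edge, hence with the other endpoint
  of that edge, along which the Morse function strictly decreases; gradients are therefore the
  same thing as partial maps \<open>q\<close> along the edges without infinite forward orbits (rooted
  forests). On the other side, row \<open>v\<close> of \<open>\<Delta> + x I\<close> is the sum of \<open>x e\<^sub>v\<close> and of
  the \<open>e\<^sub>v - e\<^sub>w\<close> over the neighbours \<open>w\<close> of \<open>v\<close>. Expanding the determinant
  multilinearly in the rows gives a sum over all partial maps \<open>q\<close> along the edges. If \<open>q\<close>
  terminates, the only permutation that contributes to its determinant is the identity; otherwise the
  indicator vector of the vertices with infinite orbit lies in the kernel.
\<close>

section \<open>Partial maps along edges and their matrices\<close>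

definition out_choices :: "'a set set \<Rightarrow> 'a \<Rightarrow> 'a option set" where
  "out_choices E v = insert None (Some ` {w. {v, w} \<in> E})"

text \<open>A height in the natural numbers stands in for the absence of infinite orbits: both the
  determinant computation and the construction of a Morse function use such a height
  directly.\<close>

definition terminating :: "'a set \<Rightarrow> ('a \<Rightarrow> 'a option) \<Rightarrow> bool" where
  "terminating V q \<longleftrightarrow> (\<exists>h::'a \<Rightarrow> nat. \<forall>v\<in>V. \<forall>w. q v = Some w \<longrightarrow> h w < h v)"

definition rooted_forests :: "'a set \<Rightarrow> 'a set set \<Rightarrow> ('a \<Rightarrow> 'a option) set" where
  "rooted_forests V E = {q \<in> PiE V (out_choices E). terminating V q}"

text \<open>The target of an arrow is stored as an undirected edge so that the result can be
  compared with \<open>gradient\<close>.\<close>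

definition arrows :: "'a set \<Rightarrow> ('a \<Rightarrow> 'a option) \<Rightarrow> ('a \<times> 'a set) set" where
  "arrows V q = {(v, {v, w}) |v w. v \<in> V \<and> q v = Some w}"

text \<open>Column \<open>u\<close> of the summand of row \<open>v\<close> that belongs to the
  choice \<open>c\<close>; \<open>None\<close> makes \<open>v\<close> a root.\<close>

definition choice_entry :: "real \<Rightarrow> 'a \<Rightarrow> 'a \<Rightarrow> 'a option \<Rightarrow> real" where
  "choice_entry x v u c = (case c of None \<Rightarrow> x * of_bool (v = u)
     | Some w \<Rightarrow> of_bool (v = u) - of_bool (w = u))"

definition choice_matrix :: "'a list \<Rightarrow> real \<Rightarrow> ('a \<Rightarrow> 'a option) \<Rightarrow> real mat" where
  "choice_matrix vs x q = mat (length vs) (length vs)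
     (\<lambda>(i, j). choice_entry x (vs ! i) (vs ! j) (q (vs ! i)))"

text \<open>The height of \<open>v\<close> is the number of points reachable from \<open>v\<close>
  in at least one step. This is finite, and an arrow from \<open>v\<close> to \<open>w\<close> loses
  at least \<open>w\<close> itself, because a wellfounded relation has no cycles.\<close>

lemma terminating_if_accp:
  assumes "finite V" "\<And>v. v \<in> V \<Longrightarrow> Wellfounded.accp (\<lambda>w v. v \<in> V \<and> q v = Some w) v"
  shows "terminating V q"
proof -
  let ?r = "\<lambda>w v. v \<in> V \<and> q v = Some w"
  define R where "R = {(w, v). ?r w v}"
  have "Wellfounded.accp ?r v" for v
    by (cases "v \<in> V") (auto intro: assms(2) accp.intros)
  then have "wfp ?r" by (rule accp_wfpI[rule_format])
  then have "wf R" by (simp add: wfp_def R_def)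
  then have irr: "(v, v) \<notin> R\<^sup>+" for v
    using wf_acyclic[of R] by (simp add: acyclic_def)
  have "R \<subseteq> (\<lambda>v. (the (q v), v)) ` V" by (force simp: R_def)
  then have "finite R" by (rule finite_surj[OF assms(1)])
  then have "finite (R\<^sup>+)" by simp
  then have fin: "finite {u. (u, v) \<in> R\<^sup>+}" for v
    by (rule finite_surj[of _ _ fst]) force
  have "card {u. (u, w) \<in> R\<^sup>+} < card {u. (u, v) \<in> R\<^sup>+}" if "v \<in> V" "q v = Some w" for v w
  proof -
    have "(w, v) \<in> R" using that by (simp add: R_def)
    then have "{u. (u, w) \<in> R\<^sup>+} \<subset> {u. (u, v) \<in> R\<^sup>+}"
      using irr by (auto intro: trancl_into_trancl)
    then show ?thesis by (rule psubset_card_mono[OF fin])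
  qed
  then show ?thesis unfolding terminating_def
    by (intro exI[of _ "\<lambda>v. card {u. (u, v) \<in> R\<^sup>+}"]) blast
qed

section \<open>Determinants of choice matrices\<close>

text \<open>Multilinearity in the rows, obtained from the Leibniz formula: each product of row sums
  distributes into a sum over choice functions, and the two sums are then exchanged.\<close>

lemma det_row_sum_expand:
  fixes g :: "nat \<Rightarrow> nat \<Rightarrow> 'c \<Rightarrow> 'b::comm_ring_1" and vs :: "'a list"
  assumes "distinct vs" and fin: "\<And>v. v \<in> set vs \<Longrightarrow> finite (D v)"
  shows "det (mat (length vs) (length vs) (\<lambda>(i, j). \<Sum>c\<in>D (vs ! i). g i j c)) =
    (\<Sum>q\<in>PiE (set vs) D. det (mat (length vs) (length vs) (\<lambda>(i, j). g i j (q (vs ! i)))))"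
proof -
  let ?n = "length vs"
  have bij: "bij_betw ((!) vs) {0..<?n} (set vs)"
    using bij_betw_nth[OF assms(1), of "{0..<?n}" "set vs"] by (simp add: atLeast0LessThan)
  \<comment> \<open>The entries depend on the row index while the choice functions live on vertices;
    \<open>idx\<close> leads back from a vertex to its row.\<close>
  define idx where "idx = inv_into {0..<?n} ((!) vs)"
  have idx: "idx (vs ! i) = i" if "i < ?n" for i
    unfolding idx_def using bij that by (intro inv_into_f_f) (auto simp: bij_betw_def)
  have distrib: "(\<Prod>i = 0..<?n. \<Sum>c\<in>D (vs ! i). g i (p i) c) =
    (\<Sum>q\<in>PiE (set vs) D. \<Prod>i = 0..<?n. g i (p i) (q (vs ! i)))" for p
  proof -
    have "(\<Prod>i = 0..<?n. \<Sum>c\<in>D (vs ! i). g i (p i) c) =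
        (\<Prod>i = 0..<?n. \<Sum>c\<in>D (vs ! i). g (idx (vs ! i)) (p (idx (vs ! i))) c)"
      by (intro prod.cong) (auto simp: idx)
    also have "\<dots> = (\<Prod>v\<in>set vs. \<Sum>c\<in>D v. g (idx v) (p (idx v)) c)"
      by (rule prod.reindex_bij_betw[OF bij])
    also have "\<dots> = (\<Sum>q\<in>PiE (set vs) D. \<Prod>v\<in>set vs. g (idx v) (p (idx v)) (q v))"
      by (rule prod_sum_PiE) (auto intro: fin)
    also have "\<dots> = (\<Sum>q\<in>PiE (set vs) D. \<Prod>i = 0..<?n.
        g (idx (vs ! i)) (p (idx (vs ! i))) (q (vs ! i)))"
      by (intro sum.cong refl prod.reindex_bij_betw[OF bij, symmetric])
    also have "\<dots> = (\<Sum>q\<in>PiE (set vs) D. \<Prod>i = 0..<?n. g i (p i) (q (vs ! i)))"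
      by (intro sum.cong prod.cong refl) (auto simp: idx)
    finally show ?thesis .
  qed
  have det_eq: "det (mat ?n ?n (\<lambda>(i, j). G i j)) =
    (\<Sum>p | p permutes {0..<?n}. signof p * (\<Prod>i = 0..<?n. G i (p i)))" for G :: "nat \<Rightarrow> nat \<Rightarrow> 'b"
  proof -
    have "p i < ?n" if "p permutes {0..<?n}" "i < ?n" for p i
      using permutes_in_image[OF that(1), of i] that(2) by simp
    then show ?thesis by (auto simp: det_def intro!: sum.cong prod.cong)
  qed
  show ?thesis
    unfolding det_eq distrib sum_distrib_left by (rule sum.swap)
qed

text \<open>A nonzero Leibniz term must follow an arrow of \<open>q\<close> at every point that its
  permutation moves, so a permutation other than the identity would run around a cycle of
  \<open>q\<close>, against the decreasing height.\<close>

lemma det_choice_matrix_terminating: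
  assumes "distinct vs" and "terminating (set vs) q"
  shows "det (choice_matrix vs x q) = x ^ card {v \<in> set vs. q v = None}"
proof -
  let ?n = "length vs" and ?e = "\<lambda>i j. choice_entry x (vs ! i) (vs ! j) (q (vs ! i))"
  obtain h :: "'a \<Rightarrow> nat" where h: "\<And>v w. v \<in> set vs \<Longrightarrow> q v = Some w \<Longrightarrow> h w < h v"
    using assms(2) unfolding terminating_def by blast
  have bij: "bij_betw ((!) vs) {0..<?n} (set vs)"
    using bij_betw_nth[OF assms(1), of "{0..<?n}" "set vs"] by (simp add: atLeast0LessThan)
  have vanish: "(\<Prod>i = 0..<?n. ?e i (p i)) = 0" if p: "p permutes {0..<?n}" "p \<noteq> id" for p
  proof -
    define S where "S = {i. p i \<noteq> i}"
    have S: "S \<subseteq> {0..<?n}" using p(1) by (auto simp: S_def permutes_def)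
    have "S \<noteq> {}" using p(2) by (auto simp: S_def)
    \<comment> \<open>At a moved index of least height, the image is moved as well and hence not
      lower, so no arrow leads there.\<close>
    then obtain i where i: "i \<in> S" and min: "\<And>j. j \<in> S \<Longrightarrow> h (vs ! i) \<le> h (vs ! j)"
      using ex_has_least_nat[of "\<lambda>i. i \<in> S" _ "\<lambda>i. h (vs ! i)"] by blast
    have "p i \<in> S" using i inj_eq[OF permutes_inj[OF p(1)]] by (simp add: S_def)
    have lt: "i < ?n" "p i < ?n" using S i \<open>p i \<in> S\<close> by auto
    have "vs ! i \<noteq> vs ! p i"
      using i lt assms(1) by (simp add: S_def nth_eq_iff_index_eq)
    moreover have "q (vs ! i) \<noteq> Some (vs ! p i)"
      using h[of "vs ! i" "vs ! p i"] min[OF \<open>p i \<in> S\<close>] lt by auto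
    ultimately have "?e i (p i) = 0"
      by (auto simp: choice_entry_def split: option.split)
    then show ?thesis using lt(1) by (intro prod_zero) auto
  qed
  have mem: "p i < ?n" if "p permutes {0..<?n}" "i < ?n" for p i
    using permutes_in_image[OF that(1), of i] that(2) by simp
  have "det (choice_matrix vs x q) =
      (\<Sum>p | p permutes {0..<?n}. signof p * (\<Prod>i = 0..<?n. ?e i (p i)))"
    unfolding choice_matrix_def by (auto simp: det_def mem intro!: sum.cong prod.cong)
  also have "\<dots> = (\<Sum>p\<in>{id}. signof p * (\<Prod>i = 0..<?n. ?e i (p i)))"
    by (intro sum.mono_neutral_right) (auto simp: finite_permutations vanish permutes_id)
  also have "\<dots> = (\<Prod>i = 0..<?n. choice_entry x (vs ! i) (vs ! i) (q (vs ! i)))" by simp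
  also have "\<dots> = (\<Prod>v\<in>set vs. choice_entry x v v (q v))"
    by (rule prod.reindex_bij_betw[OF bij])
  \<comment> \<open>A fixed point \<open>q v = Some v\<close> would give the entry 0 instead of 1;
    the height excludes it.\<close>
  also have "\<dots> = (\<Prod>v\<in>set vs. if q v = None then x else 1)"
    by (intro prod.cong) (auto simp: choice_entry_def split: option.split dest: h)
  also have "\<dots> = x ^ card {v \<in> set vs. q v = None}"
    by (simp add: prod.If_cases Int_def)
  finally show ?thesis .
qed

lemma det_choice_matrix_not_terminating:
  assumes "distinct vs" and ran: "\<And>v w. v \<in> set vs \<Longrightarrow> q v = Some w \<Longrightarrow> w \<in> set vs"
    and "\<not> terminating (set vs) q"
  shows "det (choice_matrix vs x q) = 0"
proof -
  let ?n = "length vs" and ?V = "set vs"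
  let ?acc = "Wellfounded.accp (\<lambda>w v. v \<in> ?V \<and> q v = Some w)"
  \<comment> \<open>Accessibility means that the forward orbit stops, so \<open>z\<close> marks the
    vertices with infinite orbit. A row evaluates on it to \<open>x * z v\<close> at a root and to
    \<open>z v - z w\<close> along an arrow, and both vanish.\<close>
  define z where "z v = (of_bool (\<not> ?acc v) :: real)" for v
  define Z where "Z = vec ?n (\<lambda>i. z (vs ! i))"
  have z_None: "z v = 0" if "q v = None" for v
    using that by (auto simp: z_def intro: accp.intros)
  have z_Some: "z w = z v" if "q v = Some w" "v \<in> ?V" for v w
  proof -
    \<comment> \<open>Since \<open>w\<close> is the only successor of \<open>v\<close>,
      accessibility passes in both directions.\<close>
    have "?acc v \<longleftrightarrow> ?acc w"
      using that by (auto intro: accp.intros dest: accp_downward)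
    then show ?thesis by (simp add: z_def)
  qed
  have bij: "bij_betw ((!) vs) {0..<?n} ?V"
    using bij_betw_nth[OF assms(1), of "{0..<?n}" ?V] by (simp add: atLeast0LessThan)
  obtain v where "v \<in> ?V" "\<not> ?acc v"
    using terminating_if_accp[of ?V q] assms(3) by blast
  then obtain i where "i < ?n" "z (vs ! i) = 1" by (auto simp: in_set_conv_nth z_def)
  then have "Z \<noteq> 0\<^sub>v ?n" by (metis Z_def index_vec index_zero_vec(1) zero_neq_one)
  moreover have "choice_matrix vs x q *\<^sub>v Z = 0\<^sub>v ?n"
  proof (rule eq_vecI)
    fix i assume "i < dim_vec (0\<^sub>v ?n :: real vec)"
    then have i: "i < ?n" by simp
    have delta: "(\<Sum>u\<in>?V. of_bool (a = u) * z u) = z a" if "a \<in> ?V" for a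
      using that by (simp add: of_bool_def if_distrib[of "\<lambda>t. t * _"] sum.delta cong: if_cong)
    have "(choice_matrix vs x q *\<^sub>v Z) $ i =
        (\<Sum>j = 0..<?n. choice_entry x (vs ! i) (vs ! j) (q (vs ! i)) * z (vs ! j))"
      using i by (simp add: choice_matrix_def Z_def scalar_prod_def)
    also have "\<dots> = (\<Sum>u\<in>?V. choice_entry x (vs ! i) u (q (vs ! i)) * z u)"
      by (rule sum.reindex_bij_betw[OF bij])
    also have "\<dots> = 0"
    proof (cases "q (vs ! i)")
      case None
      then show ?thesis
        using delta[of "vs ! i"] z_None[of "vs ! i"] i
        by (simp add: choice_entry_def mult.assoc flip: sum_distrib_left)
    next
      case (Some w)
      then show ?thesis
        using delta[of "vs ! i"] delta[of w] z_Some[of "vs ! i" w] ran[of "vs ! i" w] i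
        by (simp add: choice_entry_def left_diff_distrib sum_subtractf)
    qed
    finally show "(choice_matrix vs x q *\<^sub>v Z) $ i = 0\<^sub>v ?n $ i" using i by simp
  qed (simp add: choice_matrix_def)
  moreover have "Z \<in> carrier_vec ?n" by (simp add: Z_def)
  moreover have "choice_matrix vs x q \<in> carrier_mat ?n ?n" by (simp add: choice_matrix_def)
  ultimately show ?thesis using det_0_iff_vec_prod_zero by blast
qed

section \<open>The shifted Laplacian as a sum over rooted forests\<close>

context finite_simple_graph
begin

lemma edge_other_end:
  assumes "e \<in> E" "v \<in> e"
  obtains w where "e = {v, w}" "w \<noteq> v"
  using edge_card[OF assms(1)] assms(2) by (auto simp: card_2_iff)

lemma edge_ends:
  assumes "{v, w} \<in> E"
  shows "v \<in> V" "w \<in> V" "v \<noteq> w"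
  using edge_subset[OF assms] edge_card[OF assms] by auto

lemma finite_neighbours: "finite {w. {v, w} \<in> E}"
  by (rule finite_subset[OF _ finite_vertices]) (auto dest: edge_ends)

lemma card_neighbours: "card {w. {v, w} \<in> E} = card {e \<in> E. v \<in> e}"
proof (rule bij_betw_same_card[of "\<lambda>w. {v, w}"])
  show "bij_betw (\<lambda>w. {v, w}) {w. {v, w} \<in> E} {e \<in> E. v \<in> e}"
    unfolding bij_betw_def
  proof
    show "(\<lambda>w. {v, w}) ` {w. {v, w} \<in> E} = {e \<in> E. v \<in> e}"
      using edge_other_end by (auto simp: image_iff) metis
  qed (auto simp: inj_on_def doubleton_eq_iff)
qed

text \<open>The choice \<open>None\<close> contributes the shift. The other choices contribute one
  diagonal unit per neighbour, adding up to the degree, and subtract the adjacency row.\<close>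

lemma laplacian_shift_eq_row_sums:
  assumes "distinct vs" "set vs = V"
  shows "laplacian vs E + x \<cdot>\<^sub>m 1\<^sub>m (length vs) = mat (length vs) (length vs)
    (\<lambda>(i, j). \<Sum>c\<in>out_choices E (vs ! i). choice_entry x (vs ! i) (vs ! j) c)"
proof (rule eq_matI)
  fix i j assume "i < dim_row (mat (length vs) (length vs)
      (\<lambda>(i, j). \<Sum>c\<in>out_choices E (vs ! i). choice_entry x (vs ! i) (vs ! j) c))"
    and "j < dim_col (mat (length vs) (length vs)
      (\<lambda>(i, j). \<Sum>c\<in>out_choices E (vs ! i). choice_entry x (vs ! i) (vs ! j) c))"
  then have ij: "i < length vs" "j < length vs" by simp_all
  let ?v = "vs ! i" and ?u = "vs ! j"
  have "(\<Sum>c\<in>out_choices E ?v. choice_entry x ?v ?u c) =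
      x * of_bool (?v = ?u) + (\<Sum>w | {?v, w} \<in> E. of_bool (?v = ?u) - of_bool (w = ?u))"
    unfolding out_choices_def
    by (subst sum.insert) (auto simp: finite_neighbours choice_entry_def sum.reindex)
  also have "\<dots> = x * of_bool (?v = ?u) + real (card {e \<in> E. ?v \<in> e}) * of_bool (?v = ?u)
      - (\<Sum>w | {?v, w} \<in> E. of_bool (w = ?u))"
    by (simp add: sum_subtractf card_neighbours)
  also have "(\<Sum>w | {?v, w} \<in> E. of_bool (w = ?u)) = (of_bool ({?v, ?u} \<in> E) :: real)"
    by (simp add: of_bool_def sum.delta finite_neighbours)
  finally show "(laplacian vs E + x \<cdot>\<^sub>m 1\<^sub>m (length vs)) $$ (i, j) = mat (length vs) (length vs)
      (\<lambda>(i, j). \<Sum>c\<in>out_choices E (vs ! i). choice_entry x (vs ! i) (vs ! j) c) $$ (i, j)"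
    using ij assms(1)
    by (simp add: laplacian_def degree_matrix_def adjacency_matrix_def nth_eq_iff_index_eq)
qed (simp_all add: laplacian_def degree_matrix_def adjacency_matrix_def)

lemma out_choices_ran:
  assumes "q \<in> PiE V (out_choices E)" "v \<in> V" "q v = Some w"
  shows "{v, w} \<in> E"
  using PiE_mem[OF assms(1,2)] assms(3) by (auto simp: out_choices_def)

lemma finite_choice_maps: "finite (PiE V (out_choices E))"
  by (intro finite_PiE finite_vertices) (auto simp: out_choices_def finite_neighbours)

lemma det_laplacian_shift_eq_sum_forests:
  assumes "distinct vs" "set vs = V"
  shows "det (laplacian vs E + x \<cdot>\<^sub>m 1\<^sub>m (length vs)) =
    (\<Sum>q\<in>rooted_forests V E. x ^ card {v \<in> V. q v = None})"
proof -
  have "det (laplacian vs E + x \<cdot>\<^sub>m 1\<^sub>m (length vs)) =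
      (\<Sum>q\<in>PiE V (out_choices E). det (choice_matrix vs x q))"
    unfolding laplacian_shift_eq_row_sums[OF assms] choice_matrix_def assms(2)[symmetric]
    by (rule det_row_sum_expand[OF assms(1)]) (auto simp: out_choices_def finite_neighbours)
  also have "\<dots> = (\<Sum>q\<in>PiE V (out_choices E).
      if terminating V q then x ^ card {v \<in> V. q v = None} else 0)"
  proof (intro sum.cong refl)
    fix q assume "q \<in> PiE V (out_choices E)"
    then have "w \<in> set vs" if "v \<in> set vs" "q v = Some w" for v w
      using out_choices_ran[of q v w] that assms(2) edge_ends by auto
    then show "det (choice_matrix vs x q) =
        (if terminating V q then x ^ card {v \<in> V. q v = None} else 0)"
      using det_choice_matrix_terminating[OF assms(1), of q x]
        det_choice_matrix_not_terminating[OF assms(1), of q x]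
      by (auto simp: assms(2))
  qed
  also have "\<dots> = (\<Sum>q\<in>rooted_forests V E. x ^ card {v \<in> V. q v = None})"
    unfolding rooted_forests_def by (rule sum.inter_filter[OF finite_choice_maps, symmetric])
  finally show ?thesis .
qed

section \<open>Gradients as rooted forests\<close>

lemma inj_on_arrows: "inj_on (arrows V) (rooted_forests V E)"
proof (rule inj_onI)
  fix q r assume q: "q \<in> rooted_forests V E" and r: "r \<in> rooted_forests V E"
    and eq: "arrows V q = arrows V r"
  have arrow: "(v, {v, w}) \<in> arrows V s \<longleftrightarrow> s v = Some w" if "v \<in> V" for s v w
    using that by (auto simp: arrows_def doubleton_eq_iff)
  have "q v = r v" if "v \<in> V" for v
    using arrow[OF that, of _ q] arrow[OF that, of _ r] eq by (metis not_Some_eq)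
  then show "q = r"
    using q r by (intro PiE_ext[of q V _ r]) (auto simp: rooted_forests_def)
qed

text \<open>The vertex condition leaves at most one edge per vertex, so the gradient is a partial
  map. The edge condition makes \<open>f\<close> decrease along it: if \<open>v\<close> is paired
  with \<open>{v, w}\<close>, then \<open>f {w} < f {v, w} \<le> f {v}\<close>.\<close>

lemma gradient_is_arrows:
  assumes "f \<in> discrete_morse_functions V E"
  shows "gradient V E f \<in> arrows V ` rooted_forests V E"
proof -
  define q where "q = restrict (\<lambda>v. if \<exists>w. (v, {v, w}) \<in> gradient V E f
    then Some (SOME w. (v, {v, w}) \<in> gradient V E f) else None) V"
  have uniq_e: "\<exists>\<^sub>\<le>\<^sub>1 e. e \<in> E \<and> v \<in> e \<and> f e \<le> f {v}" if "v \<in> V" for v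
    using assms that by (simp add: discrete_morse_functions_def)
  have uniq_v: "\<exists>\<^sub>\<le>\<^sub>1 v. v \<in> e \<and> f {v} \<ge> f e" if "e \<in> E" for e
    using assms that by (simp add: discrete_morse_functions_def)
  have q_grad: "(v, {v, w}) \<in> gradient V E f" if "q v = Some w" "v \<in> V" for v w
    using that by (auto simp: q_def split: if_splits intro: someI_ex)
  have grad_q: "q v = Some w" if g: "(v, {v, w}) \<in> gradient V E f" for v w
  proof -
    have v: "v \<in> V" using g by (simp add: gradient_def)
    obtain w' where w': "q v = Some w'" using g v by (fastforce simp: q_def)
    have "{v, w} = {v, w'}"
      using q_grad[OF w' v] g Uniq_D[OF uniq_e[OF v]] by (auto simp: gradient_def)
    then show ?thesis using w' by (auto simp: doubleton_eq_iff)
  qed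
  have "gradient V E f = arrows V q"
  proof (intro equalityI subrelI)
    fix v e assume g: "(v, e) \<in> gradient V E f"
    then obtain w where "e = {v, w}" by (auto simp: gradient_def elim: edge_other_end)
    then show "(v, e) \<in> arrows V q" using g grad_q by (auto simp: arrows_def gradient_def)
  qed (auto simp: arrows_def q_grad)
  moreover have "q \<in> PiE V (out_choices E)"
  proof (rule PiE_I)
    fix v assume "v \<in> V"
    then show "q v \<in> out_choices E v"
      using q_grad[of v] by (cases "q v") (auto simp: out_choices_def gradient_def)
  qed (simp add: q_def)
  moreover have "terminating V q"
  proof -
    have dec: "f {w} < f {v}" if "v \<in> V" "q v = Some w" for v w
    proof -
      have e: "{v, w} \<in> E" "f {v, w} \<le> f {v}" using q_grad[OF that(2,1)] by (auto simp: gradient_def)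
      have "\<not> f {w} \<ge> f {v, w}"
        using Uniq_D[OF uniq_v[OF e(1)], of v w] e edge_ends(3)[OF e(1)] by auto
      then show ?thesis using e by simp
    qed
    \<comment> \<open>The real values are replaced by their ranks among the finitely many vertex
      values, which gives a height in the natural numbers.\<close>
    have "card {u \<in> V. f {u} < f {w}} < card {u \<in> V. f {u} < f {v}}"
      if "v \<in> V" "q v = Some w" for v w
    proof (rule psubset_card_mono)
      have "w \<in> V" using q_grad[OF that(2,1)] edge_ends by (auto simp: gradient_def)
      then show "{u \<in> V. f {u} < f {w}} \<subset> {u \<in> V. f {u} < f {v}}"
        using dec[OF that] by auto
    qed (simp add: finite_vertices)
    then show ?thesis unfolding terminating_def
      by (intro exI[of _ "\<lambda>v. card {u \<in> V. f {u} < f {v}}"]) blast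
  qed
  ultimately show ?thesis by (auto simp: rooted_forests_def)
qed

lemma arrows_is_gradient:
  assumes "q \<in> rooted_forests V E"
  shows "arrows V q \<in> gradient V E ` discrete_morse_functions V E"
proof -
  obtain h :: "'a \<Rightarrow> nat" where h: "\<And>v w. v \<in> V \<Longrightarrow> q v = Some w \<Longrightarrow> h w < h v"
    using assms by (auto simp: rooted_forests_def terminating_def)
  have edge: "{v, w} \<in> E" if "v \<in> V" "q v = Some w" for v w
    using out_choices_ran that assms by (auto simp: rooted_forests_def)
  text \<open>An edge sits at the height of its higher endpoint if \<open>q\<close> uses it, and above both
    endpoints otherwise.\<close>
  define f where "f = restrict (\<lambda>c. real (Max (h ` c)) +
    of_bool (c \<in> E \<and> c \<notin> snd ` arrows V q)) (cells V E)"
  \<comment> \<open>A singleton is never an edge, so the extra summand is 0 on vertices.\<close>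
  have f_v: "f {v} = h v" if "v \<in> V" for v
    using that edge_card[of "{v}"] by (auto simp: f_def cells_def)
  have f_e: "f e = real (Max (h ` e)) + of_bool (e \<notin> snd ` arrows V q)" if "e \<in> E" for e
    using that by (auto simp: f_def cells_def)
  \<comment> \<open>Both Morse conditions and the gradient of \<open>f\<close> are read off from
    this equivalence.\<close>
  have iff: "f e \<le> f {v} \<longleftrightarrow> (v, e) \<in> arrows V q" if ev: "e \<in> E" "v \<in> e" for e v
  proof -
    obtain w where e: "e = {v, w}" "w \<noteq> v" by (rule edge_other_end[OF ev])
    have V: "v \<in> V" "w \<in> V" using edge_ends that(1) e by auto
    show ?thesis
    proof (cases "e \<in> snd ` arrows V q")
      case False
      then have "(v, e) \<notin> arrows V q" by force
      moreover have "Max (h ` e) \<ge> h v" using e by simp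
      ultimately show ?thesis using False f_e[OF that(1)] f_v[OF V(1)] by simp
    next
      case True
      then obtain a b where ab: "e = {a, b}" "a \<in> V" "q a = Some b" by (auto simp: arrows_def)
      \<comment> \<open>The source of an arrow is its strictly higher endpoint, so it alone reaches
        the value of the edge.\<close>
      have "Max (h ` e) = h a" using h[OF ab(2,3)] ab(1) by (simp add: max_def)
      then have le: "f e \<le> f {v} \<longleftrightarrow> h a \<le> h v" using True f_e[OF that(1)] f_v[OF V(1)] by simp
      show ?thesis
      proof (cases "v = a")
        case True
        then show ?thesis using le ab by (auto simp: arrows_def)
      next
        case False
        then have vb: "v = b" "w = a" using e ab(1) by (auto simp: doubleton_eq_iff)
        have "(v, e) \<notin> arrows V q"
        proof
          assume "(v, e) \<in> arrows V q"
          then have "q v = Some w" using e by (auto simp: arrows_def doubleton_eq_iff)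
          then show False using h[OF V(1)] h[OF ab(2,3)] vb by fastforce
        qed
        then show ?thesis using le h[OF ab(2,3)] vb by simp
      qed
    qed
  qed
  have "\<exists>\<^sub>\<le>\<^sub>1 e. e \<in> E \<and> v \<in> e \<and> f e \<le> f {v}" if "v \<in> V" for v
    by (rule Uniq_I) (auto simp: iff, auto simp: arrows_def)
  moreover have "\<exists>\<^sub>\<le>\<^sub>1 v. v \<in> e \<and> f {v} \<ge> f e" if "e \<in> E" for e
  proof (rule Uniq_I)
    fix a b assume "a \<in> e \<and> f {a} \<ge> f e" "b \<in> e \<and> f {b} \<ge> f e"
    then have "(a, e) \<in> arrows V q" "(b, e) \<in> arrows V q" using iff that by auto
    \<comment> \<open>Distinct \<open>a\<close> and \<open>b\<close> would be joined by arrows in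
      both directions, and the height would drop both ways.\<close>
    then show "a = b"
      using h[of a b] h[of b a] by (auto simp: arrows_def doubleton_eq_iff)
  qed
  moreover have "f \<in> extensional (cells V E)" by (simp add: f_def)
  ultimately have "f \<in> discrete_morse_functions V E" by (simp add: discrete_morse_functions_def)
  moreover have "gradient V E f = arrows V q"
  proof (intro equalityI subrelI)
    fix v e assume "(v, e) \<in> arrows V q"
    then show "(v, e) \<in> gradient V E f"
      using iff[of e v] edge by (auto simp: gradient_def arrows_def)
  qed (auto simp: gradient_def iff)
  ultimately show ?thesis by (metis image_eqI)
qed

lemma gradients_eq_arrows:
  "gradient V E ` discrete_morse_functions V E = arrows V ` rooted_forests V E"
  using gradient_is_arrows arrows_is_gradient by blast

section \<open>Counting arrows, critical edges and classes\<close>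

lemma card_arrows: "card (arrows V q) + card {v \<in> V. q v = None} = card V"
proof -
  have "arrows V q = (\<lambda>v. (v, {v, the (q v)})) ` {v \<in> V. q v \<noteq> None}"
    by (force simp: arrows_def)
  moreover have "inj_on (\<lambda>v. (v, {v, the (q v)})) A" for A by (auto simp: inj_on_def)
  ultimately have "card (arrows V q) = card {v \<in> V. q v \<noteq> None}" by (simp add: card_image)
  moreover have "card V = card {v \<in> V. q v \<noteq> None} + card {v \<in> V. q v = None}"
    using finite_vertices by (subst card_Un_disjoint[symmetric]) (auto intro: arg_cong[where f = card])
  ultimately show ?thesis by simp
qed

lemma card_arrows_le: "card (arrows V q) \<le> card V"
  using card_arrows[of q] by simp

text \<open>The noncritical edges are the second components of the gradient, and the edge condition
  lets each of them occur in only one pair.\<close>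

lemma card_critical_edges:
  assumes "f \<in> discrete_morse_functions V E"
  shows "int (card {e \<in> E. critical V E f e}) = int (card E) - int (card (gradient V E f))"
proof -
  have "critical V E f e \<longleftrightarrow> e \<notin> snd ` gradient V E f" if "e \<in> E" for e
  proof -
    have "e \<noteq> {v}" for v using edge_card[OF that] by auto
    then have "critical V E f e \<longleftrightarrow> \<not> (\<exists>v\<in>V. v \<in> e \<and> f e \<le> f {v})"
      using that by (auto simp: critical_def cells_def)
    also have "\<dots> \<longleftrightarrow> e \<notin> snd ` gradient V E f"
      using that by (auto simp: gradient_def image_iff)
    finally show ?thesis .
  qed
  then have "{e \<in> E. critical V E f e} = E - snd ` gradient V E f" by auto
  moreover have sub: "snd ` gradient V E f \<subseteq> E" by (auto simp: gradient_def)
  moreover have "inj_on snd (gradient V E f)"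
  proof (rule inj_onI)
    fix a b assume "a \<in> gradient V E f" "b \<in> gradient V E f" "snd a = snd b"
    then obtain v w e where *: "a = (v, e)" "b = (w, e)" "e \<in> E"
      and "v \<in> e \<and> f {v} \<ge> f e" "w \<in> e \<and> f {w} \<ge> f e"
      by (cases a; cases b) (auto simp: gradient_def)
    moreover have "\<exists>\<^sub>\<le>\<^sub>1 v. v \<in> e \<and> f {v} \<ge> f e"
      using assms *(3) by (simp add: discrete_morse_functions_def)
    ultimately show "a = b" by (auto dest: Uniq_D)
  qed
  then have "card (snd ` gradient V E f) = card (gradient V E f)" by (rule card_image)
  moreover have "card (snd ` gradient V E f) \<le> card E" by (rule card_mono[OF finite_edges sub])
  ultimately show ?thesis
    by (simp add: card_Diff_subset finite_subset[OF sub finite_edges] of_nat_diff)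
qed

text \<open>Classes are the nonempty fibres of \<open>gradient\<close>, hence correspond to
  gradients and so to rooted forests; the number of critical edges is fixed by the number of arrows.
  Integer subtraction keeps this valid for \<open>i\<close> above \<open>card E\<close>.\<close>

lemma card_morse_classes_crit:
  "card (morse_classes_crit V E (int (card E) - int i)) =
    card {q \<in> rooted_forests V E. card (arrows V q) = i}"
proof -
  let ?M = "discrete_morse_functions V E"
  let ?G = "{P \<in> gradient V E ` ?M. card P = i}"
  define cls where "cls P = {f \<in> ?M. gradient V E f = P}" for P
  have "morse_classes V E = cls ` gradient V E ` ?M"
    by (auto simp: morse_classes_def quotient_def gradient_equiv_def cls_def)
  then have "morse_classes_crit V E (int (card E) - int i) = cls ` {P \<in> gradient V E ` ?M.
      \<exists>f\<in>cls P. int (card {e \<in> E. critical V E f e}) = int (card E) - int i}"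
    unfolding morse_classes_crit_def by (simp only: Compr_image_eq)
  moreover have "(\<exists>f\<in>cls P. int (card {e \<in> E. critical V E f e}) = int (card E) - int i) \<longleftrightarrow>
      card P = i" if "P \<in> gradient V E ` ?M" for P
    using that by (auto simp: cls_def card_critical_edges)
  ultimately have "morse_classes_crit V E (int (card E) - int i) = cls ` ?G"
    by (simp cong: conj_cong)
  \<comment> \<open>Every member of \<open>?G\<close> is attained as a gradient, so its fibre is
    nonempty and determines it.\<close>
  moreover have "inj_on cls ?G" by (auto simp: inj_on_def cls_def)
  ultimately have "card (morse_classes_crit V E (int (card E) - int i)) = card ?G"
    by (simp add: card_image)
  also have "?G = arrows V ` {q \<in> rooted_forests V E. card (arrows V q) = i}"
    unfolding gradients_eq_arrows by auto
  also have "card \<dots> = card {q \<in> rooted_forests V E. card (arrows V q) = i}"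
    by (rule card_image[OF inj_on_subset[OF inj_on_arrows]]) auto
  finally show ?thesis .
qed

end

theorem theorem3p6:
  fixes V :: "'a set" and E :: "'a set set" and vs :: "'a list" and x :: real
  assumes "finite_simple_graph V E"
    and "distinct vs" and "set vs = V"
  shows "det (laplacian vs E + x \<cdot>\<^sub>m 1\<^sub>m (card V)) =
    (\<Sum>i=0..card V. real (card (morse_classes_crit V E (int (card E) - int i))) * x ^ (card V - i))"
proof -
  interpret finite_simple_graph V E by (rule assms(1))
  let ?F = "rooted_forests V E"
  have card_V: "card V = length vs" using assms distinct_card by blast
  have fin: "finite ?F" using finite_choice_maps by (simp add: rooted_forests_def)
  have "det (laplacian vs E + x \<cdot>\<^sub>m 1\<^sub>m (card V)) = (\<Sum>q\<in>?F. x ^ card {v \<in> V. q v = None})"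
    unfolding card_V by (rule det_laplacian_shift_eq_sum_forests[OF assms(2,3)])
  also have "\<dots> = (\<Sum>q\<in>?F. x ^ (card V - card (arrows V q)))"
    by (intro sum.cong refl arg_cong[where f = "(^) x"]) (metis card_arrows add_diff_cancel_left')
  \<comment> \<open>Forests are grouped by their number of arrows, which is at most
    \<open>card V\<close> because each vertex emits at most one.\<close>
  also have "\<dots> = (\<Sum>i=0..card V. \<Sum>q | q \<in> ?F \<and> card (arrows V q) = i.
      x ^ (card V - card (arrows V q)))"
    by (rule sum.group[symmetric, OF fin]) (auto simp: card_arrows_le)
  also have "\<dots> = (\<Sum>i=0..card V. real (card {q \<in> ?F. card (arrows V q) = i}) * x ^ (card V - i))"
    by (intro sum.cong refl) simp
  finally show ?thesis by (simp add: card_morse_classes_crit)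
qed

end
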